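(* Let $\varepsilon>0$ and suppose $A \ge \frac{9}{32}\left(\frac{49}{16}\right)^4\varepsilon^{-2}$. Then for any time step $\Delta t>0$, the numerical solution produced by the third order BDF scheme (each $u^{n+1}$ is determined from $u^n,u^{n-1},u^{n-2}$ by) $$\frac{\frac{11}{6} u^{n+1} - 3 u^n + \frac32 u^{n-1} - \frac13 u^{n-2}}{\Delta t}+\varepsilon^2 \Delta_N^2 u^{n+1} + \nabla_N \cdot \Bigl( 3 \frac{\nabla_N u^n}{1+ |\nabla_N u^n|^2} -3 \frac{\nabla_N u^{n-1}}{1+ |\nabla_N u^{n-1}|^2} + \frac{\nabla_N u^{n-2}}{1+ |\nabla_N u^{n-2}|^2} \Bigr) +A \Delta t^2 \Delta_N^2( u^{n+1} - u^n) = 0$$ satisfies, at every step $n$, $$\tilde{E}_N (u^{n+1} , u^n, u^{n-1}) \le \tilde{E}_N (u^n, u^{n-1}, u^{n-2}),$$ where $$\tilde{E}_N (u^{n+1} , u^n, u^{n-1}) = E_N (u^{n+1}) + \frac{3}{4 \Delta t} \| u^{n+1} - u^n \|_2^2 + \frac{1}{6 \Delta t} \| u^n - u^{n-1} \|_2^2 + \frac32 \| \nabla_N ( u^{n+1} - u^n ) \|_2^2 + \frac12 \| \nabla_N ( u^n - u^{n-1} ) \|_2^2 .$$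
   Context: Setting: $\Omega=(0,1)^2$ with periodic boundary conditions, $N=2K+1$ with $K$ a positive integer, $h=1/N$, grid points $(x_i,y_j)=(ih,jh)$. All $u^k$ are real-valued periodic grid functions on this grid ($u^k$ approximates the solution at time $k\Delta t$). A periodic grid function has the discrete Fourier expansion $f_{i,j}=\sum_{k,\ell=-K}^{K}\hat f_{k,\ell}\exp(2\pi \mathrm{i}(kx_i+\ell y_j))$. The pseudo-spectral derivatives are $(\mathcal D_{Nx}f)_{i,j}=\sum_{k,\ell=-K}^{K}(2k\pi \mathrm{i})\hat f_{k,\ell}\exp(2\pi \mathrm{i}(kx_i+\ell y_j))$, $(\mathcal D_{Nx}^2f)_{i,j}=\sum_{k,\ell=-K}^{K}(-4\pi^2k^2)\hat f_{k,\ell}\exp(2\pi \mathrm{i}(kx_i+\ell y_j))$, and similarly $\mathcal D_{Ny},\mathcal D_{Ny}^2$ in the $y$ direction (with $\ell$ in place of $k$ in the multiplier). Then $\Delta_N f=(\mathcal D_{Nx}^2+\mathcal D_{Ny}^2)f$, $\nabla_N f=(\mathcal D_{Nx}f,\mathcal D_{Ny}f)^T$, $\nabla_N\cdot(f_1,f_2)^T=\mathcal D_{Nx}f_1+\mathcal D_{Ny}f_2$. Nonlinear expressions such as $\frac{\nabla_N u}{1+|\nabla_N u|^2}$ are evaluated pointwise on the grid, with $|\cdot|$ the Euclidean norm in $\mathbb R^2$. Discrete inner product and norm: $\langle f,g\rangle=h^2\sum_{i,j=0}^{N-1}f_{i,j}g_{i,j}$, $\|f\|_2=\sqrt{\langle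 f,f\rangle}$; for vector grid functions the inner product is summed over components. Discrete energy: $E_N(\phi)=E_{c,1,N}(\phi)+\frac{\varepsilon^2}{2}\|\Delta_N\phi\|_2^2$ with $E_{c,1,N}(\phi)=h^2\sum_{i,j=0}^{N-1}\left(-\frac12\ln\left(1+|\nabla_N\phi|^2\right)_{i,j}\right)$. *)

theory Defs
  imports "HOL-Analysis.Analysis"
begin

text \<open>
  The uniform periodic grid on \<open>(0,1)\<^sup>2\<close> has \<open>N = 2 K + 1\<close> points per direction.  Grid functions are
  indexed by all pairs of integers and required to be \<open>N\<close>-periodic in each index; the value type is
  \<open>real\<close> for scalar and \<open>real \<times> real\<close> for vector grid functions.
\<close>

type_synonym 'a grid_fun = "int \<Rightarrow> int \<Rightarrow> 'a"

definition grid_size :: "nat \<Rightarrow> nat" where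
  "grid_size K = 2 * K + 1"

definition mesh :: "nat \<Rightarrow> real" where
  "mesh K = 1 / real (grid_size K)"

definition node :: "nat \<Rightarrow> int \<Rightarrow> real" where
  "node K i = of_int i * mesh K"

definition periodic_grid_fun :: "nat \<Rightarrow> 'a grid_fun \<Rightarrow> bool" where
  "periodic_grid_fun K f \<longleftrightarrow>
     (\<forall>i j. f (i + int (grid_size K)) j = f i j \<and> f i (j + int (grid_size K)) = f i j)"

definition fourier_mode :: "nat \<Rightarrow> int \<Rightarrow> int \<Rightarrow> complex grid_fun" where
  "fourier_mode K k l i j =
     exp (2 * of_real pi * \<i> * of_real (of_int k * node K i + of_int l * node K j))"

text \<open>
  These are the coefficients of the discrete Fourier expansion of \<open>f\<close>; see
  \<open>fourier_expansion\<close> and \<open>fourier_coeff_unique\<close> below.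
\<close>

definition fourier_coeff :: "nat \<Rightarrow> real grid_fun \<Rightarrow> int \<Rightarrow> int \<Rightarrow> complex" where
  "fourier_coeff K f k l =
     of_real ((mesh K)\<^sup>2) *
     (\<Sum>i = 0..<int (grid_size K). \<Sum>j = 0..<int (grid_size K).
        of_real (f i j) * cnj (fourier_mode K k l i j))"

definition spectral_sum ::
    "nat \<Rightarrow> (int \<Rightarrow> int \<Rightarrow> complex) \<Rightarrow> real grid_fun \<Rightarrow> complex grid_fun" where
  "spectral_sum K m f i j =
     (\<Sum>k = - int K..int K. \<Sum>l = - int K..int K.
        m k l * fourier_coeff K f k l * fourier_mode K k l i j)"

text \<open>
  For the multipliers used below the sums are real numbers (\<open>spectral_sum_real\<close>), so taking the
  real part only changes the type.
\<close>

definition D_x :: "nat \<Rightarrow> real grid_fun \<Rightarrow> real grid_fun" where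
  "D_x K f i j = Re (spectral_sum K (\<lambda>k l. 2 * of_int k * of_real pi * \<i>) f i j)"

definition D_y :: "nat \<Rightarrow> real grid_fun \<Rightarrow> real grid_fun" where
  "D_y K f i j = Re (spectral_sum K (\<lambda>k l. 2 * of_int l * of_real pi * \<i>) f i j)"

definition D_xx :: "nat \<Rightarrow> real grid_fun \<Rightarrow> real grid_fun" where
  "D_xx K f i j = Re (spectral_sum K (\<lambda>k l. - 4 * (of_real pi)\<^sup>2 * (of_int k)\<^sup>2) f i j)"

definition D_yy :: "nat \<Rightarrow> real grid_fun \<Rightarrow> real grid_fun" where
  "D_yy K f i j = Re (spectral_sum K (\<lambda>k l. - 4 * (of_real pi)\<^sup>2 * (of_int l)\<^sup>2) f i j)"

definition laplacian :: "nat \<Rightarrow> real grid_fun \<Rightarrow> real grid_fun" where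
  "laplacian K f i j = D_xx K f i j + D_yy K f i j"

definition gradient :: "nat \<Rightarrow> real grid_fun \<Rightarrow> (real \<times> real) grid_fun" where
  "gradient K f i j = (D_x K f i j, D_y K f i j)"

definition divergence :: "nat \<Rightarrow> (real \<times> real) grid_fun \<Rightarrow> real grid_fun" where
  "divergence K F i j = D_x K (\<lambda>i j. fst (F i j)) i j + D_y K (\<lambda>i j. snd (F i j)) i j"

text \<open>For vector grid functions the pointwise \<open>\<bullet>\<close> already sums over the components.\<close>

definition grid_inner :: "nat \<Rightarrow> 'a::real_inner grid_fun \<Rightarrow> 'a grid_fun \<Rightarrow> real" where
  "grid_inner K f g =
     (mesh K)\<^sup>2 *
     (\<Sum>i = 0..<int (grid_size K). \<Sum>j = 0..<int (grid_size K). f i j \<bullet> g i j)"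

definition grid_norm :: "nat \<Rightarrow> 'a::real_inner grid_fun \<Rightarrow> real" where
  "grid_norm K f = sqrt (grid_inner K f f)"

definition energy_c1 :: "nat \<Rightarrow> real grid_fun \<Rightarrow> real" where
  "energy_c1 K \<phi> =
     (mesh K)\<^sup>2 *
     (\<Sum>i = 0..<int (grid_size K). \<Sum>j = 0..<int (grid_size K).
        - (1 / 2) * ln (1 + (norm (gradient K \<phi> i j))\<^sup>2))"

definition energy :: "nat \<Rightarrow> real \<Rightarrow> real grid_fun \<Rightarrow> real" where
  "energy K \<epsilon> \<phi> = energy_c1 K \<phi> + \<epsilon>\<^sup>2 / 2 * (grid_norm K (laplacian K \<phi>))\<^sup>2"

definition modified_energy ::
    "nat \<Rightarrow> real \<Rightarrow> real \<Rightarrow> real grid_fun \<Rightarrow> real grid_fun \<Rightarrow> real grid_fun \<Rightarrow> real" where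
  "modified_energy K \<epsilon> \<tau> v2 v1 v0 =
     energy K \<epsilon> v2
     + 3 / (4 * \<tau>) * (grid_norm K (\<lambda>i j. v2 i j - v1 i j))\<^sup>2
     + 1 / (6 * \<tau>) * (grid_norm K (\<lambda>i j. v1 i j - v0 i j))\<^sup>2
     + 3 / 2 * (grid_norm K (gradient K (\<lambda>i j. v2 i j - v1 i j)))\<^sup>2
     + 1 / 2 * (grid_norm K (gradient K (\<lambda>i j. v1 i j - v0 i j)))\<^sup>2"

definition nonlin_flux :: "nat \<Rightarrow> real grid_fun \<Rightarrow> (real \<times> real) grid_fun" where
  "nonlin_flux K v i j = gradient K v i j /\<^sub>R (1 + (norm (gradient K v i j))\<^sup>2)"

text \<open>
  \<open>bdf3_step K \<epsilon> A \<tau> v3 v2 v1 v0\<close>: the third order BDF scheme with time step \<open>\<tau>\<close> holds for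
  \<open>v3, v2, v1, v0\<close> in the roles of the approximations at steps \<open>n + 1, n, n - 1, n - 2\<close>.
\<close>

definition bdf3_step ::
    "nat \<Rightarrow> real \<Rightarrow> real \<Rightarrow> real \<Rightarrow>
     real grid_fun \<Rightarrow> real grid_fun \<Rightarrow> real grid_fun \<Rightarrow> real grid_fun \<Rightarrow> bool" where
  "bdf3_step K \<epsilon> A \<tau> v3 v2 v1 v0 \<longleftrightarrow>
     (\<forall>i j.
        (11 / 6 * v3 i j - 3 * v2 i j + 3 / 2 * v1 i j - 1 / 3 * v0 i j) / \<tau>
        + \<epsilon>\<^sup>2 * laplacian K (laplacian K v3) i j
        + divergence K
            (\<lambda>i j. 3 *\<^sub>R nonlin_flux K v2 i j - 3 *\<^sub>R nonlin_flux K v1 i j + nonlin_flux K v0 i j) i j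
        + A * \<tau>\<^sup>2 * laplacian K (laplacian K (\<lambda>i j. v3 i j - v2 i j)) i j
        = 0)"

lemma cnj_fourier_mode: "cnj (fourier_mode K k l i j) = fourier_mode K (- k) (- l) i j"
  by (simp add: fourier_mode_def exp_cnj algebra_simps)

lemma fourier_coeff_uminus: "fourier_coeff K f (- k) (- l) = cnj (fourier_coeff K f k l)"
  by (simp add: fourier_coeff_def cnj_fourier_mode)

lemma spectral_sum_real:
  assumes "\<And>k l. m (- k) (- l) = cnj (m k l)"
  shows "of_real (Re (spectral_sum K m f i j)) = spectral_sum K m f i j"
proof -
  have "cnj (spectral_sum K m f i j) =
      (\<Sum>k = - int K..int K. \<Sum>l = - int K..int K.
        m (- k) (- l) * fourier_coeff K f (- k) (- l) * fourier_mode K (- k) (- l) i j)"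
    by (simp add: spectral_sum_def cnj_fourier_mode fourier_coeff_uminus assms)
  also have "\<dots> = (\<Sum>k = - int K..int K. \<Sum>l = - int K..int K.
        m k (- l) * fourier_coeff K f k (- l) * fourier_mode K k (- l) i j)"
    by (rule sum.reindex_bij_witness[of _ uminus uminus]) auto
  also have "\<dots> = spectral_sum K m f i j"
    unfolding spectral_sum_def
    by (intro sum.cong refl sum.reindex_bij_witness[of _ uminus uminus]) auto
  finally show ?thesis
    by (simp add: complex_eq_iff)
qed

lemma of_real_D:
  "of_real (D_x K f i j) = spectral_sum K (\<lambda>k l. 2 * of_int k * of_real pi * \<i>) f i j"
  "of_real (D_y K f i j) = spectral_sum K (\<lambda>k l. 2 * of_int l * of_real pi * \<i>) f i j"
  "of_real (D_xx K f i j) = spectral_sum K (\<lambda>k l. - 4 * (of_real pi)\<^sup>2 * (of_int k)\<^sup>2) f i j"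
  "of_real (D_yy K f i j) = spectral_sum K (\<lambda>k l. - 4 * (of_real pi)\<^sup>2 * (of_int l)\<^sup>2) f i j"
  by (simp_all add: D_x_def D_y_def D_xx_def D_yy_def spectral_sum_real)

definition root_N :: "nat \<Rightarrow> int \<Rightarrow> complex" where
  "root_N K m = exp (2 * of_real pi * \<i> * of_real (of_int m * mesh K))"

lemma root_N_add: "root_N K (a + b) = root_N K a * root_N K b"
  by (simp add: root_N_def algebra_simps flip: exp_add)

lemma root_N_power: "root_N K (m * int n) = root_N K m ^ n"
  by (simp add: root_N_def algebra_simps flip: exp_of_nat_mult)

lemma fourier_mode_root: "fourier_mode K k l i j = root_N K (k * i) * root_N K (l * j)"
  by (simp add: fourier_mode_def root_N_def node_def algebra_simps flip: exp_add)

lemma root_N_eq_1_iff: "root_N K m = 1 \<longleftrightarrow> int (grid_size K) dvd m"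
proof -
  have pos: "real (grid_size K) > 0" by (simp add: grid_size_def)
  have "root_N K m = 1 \<longleftrightarrow> (\<exists>n::int. 2 * pi * (of_int m * mesh K) = of_int (2 * n) * pi)"
    by (simp add: root_N_def exp_eq_1)
  also have "\<dots> \<longleftrightarrow> (\<exists>n::int. real_of_int m = of_int (int (grid_size K) * n))"
    using pos by (intro ex_cong1) (simp add: mesh_def field_simps)
  also have "\<dots> \<longleftrightarrow> int (grid_size K) dvd m"
    unfolding of_int_eq_iff dvd_def ..
  finally show ?thesis .
qed

lemma root_N_geometric:
  "(\<Sum>i = 0..<int (grid_size K). root_N K (m * i)) =
     (if int (grid_size K) dvd m then of_nat (grid_size K) else 0)"
proof -
  have "(\<Sum>i = 0..<int (grid_size K). root_N K (m * i)) = (\<Sum>n<grid_size K. root_N K m ^ n)"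
    by (rule sum.reindex_bij_witness[of _ int nat]) (auto simp flip: root_N_power)
  moreover have "root_N K m ^ grid_size K = 1"
    by (simp add: root_N_eq_1_iff flip: root_N_power)
  ultimately show ?thesis
    by (cases "root_N K m = 1") (auto simp: geometric_sum simp flip: root_N_eq_1_iff)
qed

lemma root_N_symmetric:
  "(\<Sum>k = - int K..int K. root_N K (k * m)) =
     (if int (grid_size K) dvd m then of_nat (grid_size K) else 0)"
proof -
  have "(\<Sum>k = - int K..int K. root_N K (k * m)) =
      (\<Sum>i = 0..<int (grid_size K). root_N K (- int K * m) * root_N K (m * i))"
    by (rule sum.reindex_bij_witness[of _ "\<lambda>i. i - int K" "\<lambda>k. k + int K"])
      (auto simp: grid_size_def algebra_simps simp flip: root_N_add)
  also have "\<dots> = (if int (grid_size K) dvd m then of_nat (grid_size K) else 0)"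
    by (simp add: root_N_eq_1_iff root_N_geometric flip: sum_distrib_left)
  finally show ?thesis .
qed

lemma root_N_cnj: "cnj (root_N K m) = root_N K (- m)"
  by (simp add: root_N_def exp_cnj)

lemma fourier_mode_mult_cnj:
  "fourier_mode K k l i j * cnj (fourier_mode K k l p q) =
     root_N K (k * (i - p)) * root_N K (l * (j - q))"
  "fourier_mode K p q i j * cnj (fourier_mode K k l i j) =
     root_N K ((p - k) * i) * root_N K ((q - l) * j)"
  by (simp_all add: fourier_mode_root root_N_cnj flip: root_N_add)
    (simp_all add: algebra_simps)

lemma periodic_add_mult:
  assumes "periodic_grid_fun K f"
  shows "f (i + n * int (grid_size K)) j = f i j" and "f i (j + n * int (grid_size K)) = f i j"
proof -
  have per: "f (i + int (grid_size K)) j = f i j" "f i (j + int (grid_size K)) = f i j" for i j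
    using assms by (auto simp: periodic_grid_fun_def)
  show "f (i + n * int (grid_size K)) j = f i j"
  proof (induction n rule: int_induct[where k = 0])
    case (step1 n)
    then show ?case using per(1)[of "i + n * int (grid_size K)" j] by (simp add: algebra_simps)
  next
    case (step2 n)
    then show ?case using per(1)[of "i + (n - 1) * int (grid_size K)" j] by (simp add: algebra_simps)
  qed simp
  show "f i (j + n * int (grid_size K)) = f i j"
  proof (induction n rule: int_induct[where k = 0])
    case (step1 n)
    then show ?case using per(2)[of i "j + n * int (grid_size K)"] by (simp add: algebra_simps)
  next
    case (step2 n)
    then show ?case using per(2)[of i "j + (n - 1) * int (grid_size K)"] by (simp add: algebra_simps)
  qed simp
qed

lemma periodic_mod:
  assumes "periodic_grid_fun K f"
  shows "f (i mod int (grid_size K)) (j mod int (grid_size K)) = f i j"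
  using periodic_add_mult(1)[OF assms, of "i mod int (grid_size K)" "i div int (grid_size K)" "j mod int (grid_size K)"]
    periodic_add_mult(2)[OF assms, of i "j mod int (grid_size K)" "j div int (grid_size K)"]
  by simp

lemma sum_swap_22:
  "(\<Sum>a\<in>A. \<Sum>b\<in>B. \<Sum>c\<in>C. \<Sum>d\<in>D. g a b c d) =
   (\<Sum>c\<in>C. \<Sum>d\<in>D. \<Sum>a\<in>A. \<Sum>b\<in>B. (g a b c d :: 'a::comm_monoid_add))"
proof -
  have "(\<Sum>a\<in>A. \<Sum>b\<in>B. \<Sum>c\<in>C. \<Sum>d\<in>D. g a b c d) =
        (\<Sum>a\<in>A. \<Sum>c\<in>C. \<Sum>b\<in>B. \<Sum>d\<in>D. g a b c d)"
    by (rule sum.cong[OF refl], rule sum.swap)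
  also have "\<dots> = (\<Sum>c\<in>C. \<Sum>a\<in>A. \<Sum>b\<in>B. \<Sum>d\<in>D. g a b c d)"
    by (rule sum.swap)
  also have "\<dots> = (\<Sum>c\<in>C. \<Sum>a\<in>A. \<Sum>d\<in>D. \<Sum>b\<in>B. g a b c d)"
    by (rule sum.cong[OF refl], rule sum.cong[OF refl], rule sum.swap)
  also have "\<dots> = (\<Sum>c\<in>C. \<Sum>d\<in>D. \<Sum>a\<in>A. \<Sum>b\<in>B. g a b c d)"
    by (rule sum.cong[OF refl], rule sum.swap)
  finally show ?thesis .
qed

lemma mesh_grid_size: "(complex_of_real (mesh K))\<^sup>2 * (of_nat (grid_size K) * of_nat (grid_size K)) = 1"
proof -
  have "complex_of_real (mesh K) * of_nat (grid_size K) = 1"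
    by (simp add: mesh_def grid_size_def del: of_nat_Suc of_nat_add of_nat_mult)
  then show ?thesis
    by (metis mult.left_neutral power2_eq_square power_mult_distrib power_one)
qed

lemma fourier_expansion:
  assumes f: "periodic_grid_fun K f"
  shows "of_real (f i j) =
    (\<Sum>k = - int K..int K. \<Sum>l = - int K..int K.
       fourier_coeff K f k l * fourier_mode K k l i j)"
proof -
  let ?N = "int (grid_size K)"
  have N: "?N > 0" by (simp add: grid_size_def)
  have dvd_iff: "?N dvd a - p \<longleftrightarrow> p = a mod ?N" if "p \<in> {0..<?N}" for a p
    using that by (auto simp flip: mod_eq_dvd_iff)
  have "(\<Sum>k = - int K..int K. \<Sum>l = - int K..int K.
       fourier_coeff K f k l * fourier_mode K k l i j) =
     (\<Sum>k = - int K..int K. \<Sum>l = - int K..int K. \<Sum>p = 0..<?N. \<Sum>q = 0..<?N.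
       (of_real (mesh K))\<^sup>2 * of_real (f p q) *
         (root_N K (k * (i - p)) * root_N K (l * (j - q))))"
    unfolding fourier_coeff_def sum_distrib_left sum_distrib_right
    by (intro sum.cong refl) (simp only: flip: fourier_mode_mult_cnj(1), simp add: mult_ac)
  also have "\<dots> = (\<Sum>p = 0..<?N. \<Sum>q = 0..<?N. (of_real (mesh K))\<^sup>2 * of_real (f p q) *
         ((\<Sum>k = - int K..int K. root_N K (k * (i - p))) * (\<Sum>l = - int K..int K. root_N K (l * (j - q)))))"
    by (subst sum_swap_22, simp only: sum_product, simp only: sum_distrib_left)
  also have "\<dots> = (\<Sum>p = 0..<?N. \<Sum>q = 0..<?N.
        if q = j mod ?N then if p = i mod ?N then of_real (f p q) else 0 else 0)"
    using mesh_grid_size[of K]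
    by (intro sum.cong refl) (simp add: root_N_symmetric dvd_iff mult_ac)
  also have "\<dots> = of_real (f (i mod ?N) (j mod ?N))"
    using N by simp
  also have "\<dots> = of_real (f i j)"
    by (simp add: periodic_mod[OF f])
  finally show ?thesis by simp
qed

lemma fourier_coeff_unique:
  assumes f: "\<And>i j. of_real (f i j) =
      (\<Sum>k = - int K..int K. \<Sum>l = - int K..int K. c k l * fourier_mode K k l i j)"
    and kl: "k \<in> {- int K..int K}" "l \<in> {- int K..int K}"
  shows "fourier_coeff K f k l = c k l"
proof -
  let ?N = "int (grid_size K)"
  have dvd_iff: "?N dvd a - b \<longleftrightarrow> a = b"
    if "a \<in> {- int K..int K}" "b \<in> {- int K..int K}" for a b
  proof
    assume "?N dvd a - b"
    moreover have "\<bar>a - b\<bar> < ?N" using that by (auto simp: grid_size_def)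
    ultimately show "a = b"
      using dvd_imp_le_int[of "a - b" ?N] by (cases "a = b") auto
  qed simp
  have "fourier_coeff K f k l =
     (\<Sum>i = 0..<?N. \<Sum>j = 0..<?N. \<Sum>p = - int K..int K. \<Sum>q = - int K..int K.
        (of_real (mesh K))\<^sup>2 * c p q * (root_N K ((p - k) * i) * root_N K ((q - l) * j)))"
    unfolding fourier_coeff_def f sum_distrib_left sum_distrib_right
    by (intro sum.cong refl) (simp only: flip: fourier_mode_mult_cnj(2), simp add: mult_ac)
  also have "\<dots> = (\<Sum>p = - int K..int K. \<Sum>q = - int K..int K. (of_real (mesh K))\<^sup>2 * c p q *
        ((\<Sum>i = 0..<?N. root_N K ((p - k) * i)) * (\<Sum>j = 0..<?N. root_N K ((q - l) * j))))"
    by (subst sum_swap_22, simp only: sum_product, simp only: sum_distrib_left)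
  also have "\<dots> = (\<Sum>p = - int K..int K. \<Sum>q = - int K..int K.
        if q = l then if p = k then c p q else 0 else 0)"
    using mesh_grid_size[of K] kl
    by (intro sum.cong refl, unfold root_N_geometric) (simp add: dvd_iff mult_ac)
  also have "\<dots> = c k l"
    using kl by simp
  finally show ?thesis .
qed

end

theory Submission
  imports Defs
begin

text \<open>
  Test the scheme with \<open>d = u\<^sup>n\<^sup>+\<^sup>1 - u\<^sup>n\<close>.  The flux is \<open>1\<close>-Lipschitz and the logarithmic part of the energy
  has Hessian at most \<open>1/8\<close>, so what the energies of the differences do not absorb is
  \<open>(1/16 + 3/2 + 3/2) \<parallel>\<nabla>d\<parallel>\<^sup>2 = 49/16 \<parallel>\<nabla>d\<parallel>\<^sup>2\<close>.  As \<open>\<parallel>\<nabla>d\<parallel>\<^sup>2 = - \<langle>\<Delta>d, d\<rangle>\<close>, it is dominated by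
  the spare \<open>\<parallel>d\<parallel>\<^sup>2 / (3 \<tau>)\<close> of the BDF difference together with
  \<open>(\<epsilon>\<^sup>2/2 + A \<tau>\<^sup>2) \<parallel>\<Delta>d\<parallel>\<^sup>2\<close>, and AM-GM in \<open>\<tau>\<close> turns the condition for this into the lower bound on \<open>A\<close>.
\<close>

section \<open>Linearity and composition of the spectral operators\<close>

lemma fourier_coeff_diff:
  "fourier_coeff K (\<lambda>i j. f i j - g i j) k l = fourier_coeff K f k l - fourier_coeff K g k l"
  by (simp add: fourier_coeff_def algebra_simps sum_subtractf)

lemma spectral_sum_diff:
  "spectral_sum K m (\<lambda>i j. f i j - g i j) i j = spectral_sum K m f i j - spectral_sum K m g i j"
  by (simp add: spectral_sum_def fourier_coeff_diff algebra_simps sum_subtractf)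

text \<open>The symmetry of \<open>m\<close> makes the inner sum real, so \<open>Re\<close> loses
  nothing and its coefficients can be read off by uniqueness of the Fourier expansion.\<close>

lemma spectral_sum_compose:
  assumes "\<And>k l. m (- k) (- l) = cnj (m k l)"
  shows "spectral_sum K m' (\<lambda>i j. Re (spectral_sum K m f i j)) i j =
    spectral_sum K (\<lambda>k l. m' k l * m k l) f i j"
proof -
  have "fourier_coeff K (\<lambda>i j. Re (spectral_sum K m f i j)) k l = m k l * fourier_coeff K f k l"
    if "k \<in> {- int K..int K}" "l \<in> {- int K..int K}" for k l
    by (rule fourier_coeff_unique[OF _ that])
      (simp add: spectral_sum_real assms, simp add: spectral_sum_def)
  then show ?thesis
    unfolding spectral_sum_def[where f = f] spectral_sum_def[where m = m'] by (simp add: mult_ac)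
qed

text \<open>Lets the Laplacian be factored as a divergence of a gradient, so that summation by parts
  is needed only for first derivatives.\<close>

lemma D_xx_eq: "D_xx K f i j = D_x K (D_x K f) i j"
  and D_yy_eq: "D_yy K f i j = D_y K (D_y K f) i j"
  by (simp_all add: D_xx_def D_yy_def D_x_def[abs_def] D_y_def[abs_def] spectral_sum_compose)
    (simp_all add: power2_eq_square algebra_simps)

lemma D_diff:
  "D_x K (\<lambda>i j. f i j - g i j) i j = D_x K f i j - D_x K g i j"
  "D_y K (\<lambda>i j. f i j - g i j) i j = D_y K f i j - D_y K g i j"
  "D_xx K (\<lambda>i j. f i j - g i j) i j = D_xx K f i j - D_xx K g i j"
  "D_yy K (\<lambda>i j. f i j - g i j) i j = D_yy K f i j - D_yy K g i j"
  by (simp_all add: D_x_def D_y_def D_xx_def D_yy_def spectral_sum_diff)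

lemma gradient_diff: "gradient K (\<lambda>i j. f i j - g i j) i j = gradient K f i j - gradient K g i j"
  by (simp add: gradient_def D_diff)

lemma laplacian_diff: "laplacian K (\<lambda>i j. f i j - g i j) i j = laplacian K f i j - laplacian K g i j"
  by (simp add: laplacian_def D_diff)

section \<open>Algebra of the discrete inner product\<close>

lemma grid_inner_add_left:
  "grid_inner K (\<lambda>i j. f i j + g i j) w = grid_inner K f w + grid_inner K g w"
  by (simp add: grid_inner_def inner_add_left sum.distrib algebra_simps)

lemma grid_inner_diff_left:
  "grid_inner K (\<lambda>i j. f i j - g i j) w = grid_inner K f w - grid_inner K g w"
  by (simp add: grid_inner_def inner_diff_left sum_subtractf algebra_simps)

lemma grid_inner_scaleR_left:
  "grid_inner K (\<lambda>i j. a *\<^sub>R f i j) w = a * grid_inner K f w"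
  by (simp add: grid_inner_def mult.left_commute flip: sum_distrib_left)

lemma grid_inner_mult_left:
  "grid_inner K (\<lambda>i j. a * f i j) (w :: real grid_fun) = a * grid_inner K f w"
  using grid_inner_scaleR_left[of K a f w] by simp

lemma grid_inner_divide_left:
  "grid_inner K (\<lambda>i j. f i j / a) (w :: real grid_fun) = grid_inner K f w / a"
  using grid_inner_mult_left[of K "1 / a" f w] by simp

lemma grid_inner_commute: "grid_inner K f g = grid_inner K g f"
  by (simp add: grid_inner_def inner_commute)

lemma grid_inner_self_nonneg: "grid_inner K f f \<ge> 0"
  by (simp add: grid_inner_def sum_nonneg)

lemma grid_norm_power2: "(grid_norm K f)\<^sup>2 = grid_inner K f f"
  by (simp add: grid_norm_def grid_inner_self_nonneg)

lemmas grid_inner_linear =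
  grid_inner_add_left grid_inner_diff_left grid_inner_scaleR_left
  grid_inner_mult_left grid_inner_divide_left

lemma grid_inner_mono:
  assumes "\<And>i j. f i j \<bullet> g i j \<le> f' i j \<bullet> g' i j"
  shows "grid_inner K f g \<le> grid_inner K f' g'"
  unfolding grid_inner_def by (intro mult_left_mono sum_mono assms) simp

lemma grid_inner_square_add:
  "grid_inner K (\<lambda>i j. f i j + s *\<^sub>R g i j) (\<lambda>i j. f i j + s *\<^sub>R g i j) =
    grid_inner K f f + 2 * s * grid_inner K g f + s\<^sup>2 * grid_inner K g g"
proof -
  let ?w = "\<lambda>i j. f i j + s *\<^sub>R g i j"
  have "grid_inner K ?w ?w = grid_inner K ?w f + s * grid_inner K ?w g"
    unfolding grid_inner_add_left[of K f] grid_inner_scaleR_left grid_inner_commute[of K _ ?w] ..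
  then show ?thesis
    by (simp add: grid_inner_linear grid_inner_commute[of K f g] power2_eq_square algebra_simps)
qed

lemma grid_inner_abs_le:
  "\<bar>grid_inner K f g\<bar> \<le> (grid_inner K f f + grid_inner K g g) / 2"
  using grid_inner_square_add[of K f 1 g] grid_inner_square_add[of K f "- 1" g]
    grid_inner_self_nonneg[of K "\<lambda>i j. f i j + 1 *\<^sub>R g i j"]
    grid_inner_self_nonneg[of K "\<lambda>i j. f i j + (- 1) *\<^sub>R g i j"]
  unfolding grid_inner_commute[of K f g] by simp

section \<open>Parseval's identity and summation by parts\<close>

lemma grid_inner_spectral_sum:
  assumes "\<And>k l. m (- k) (- l) = cnj (m k l)"
  shows "of_real (grid_inner K (\<lambda>i j. Re (spectral_sum K m f i j)) g) =
    (\<Sum>k = - int K..int K. \<Sum>l = - int K..int K.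
       m k l * fourier_coeff K f k l * cnj (fourier_coeff K g k l))"
proof -
  have "of_real (grid_inner K (\<lambda>i j. Re (spectral_sum K m f i j)) g) =
    of_real ((mesh K)\<^sup>2) * (\<Sum>i = 0..<int (grid_size K). \<Sum>j = 0..<int (grid_size K).
       spectral_sum K m f i j * of_real (g i j))"
    by (simp add: grid_inner_def spectral_sum_real[of m, OF assms])
  also have "\<dots> = (\<Sum>k = - int K..int K. \<Sum>l = - int K..int K.
       m k l * fourier_coeff K f k l * (of_real ((mesh K)\<^sup>2) *
       (\<Sum>i = 0..<int (grid_size K). \<Sum>j = 0..<int (grid_size K).
          of_real (g i j) * fourier_mode K k l i j)))"
    unfolding spectral_sum_def sum_distrib_left sum_distrib_right
    by (subst sum_swap_22) (simp add: mult_ac)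
  finally show ?thesis by (simp add: fourier_coeff_def)
qed

text \<open>In Parseval's form, conjugating the real inner product swaps \<open>f\<close> with
  \<open>g\<close> and conjugates the multiplier, which is purely imaginary and so yields the
  sign.\<close>

lemma grid_inner_spectral_sum_skew:
  assumes "\<And>k l. m (- k) (- l) = cnj (m k l)" and "\<And>k l. cnj (m k l) = - m k l"
  shows "grid_inner K (\<lambda>i j. Re (spectral_sum K m f i j)) g =
    - grid_inner K f (\<lambda>i j. Re (spectral_sum K m g i j))"
proof -
  have "complex_of_real (grid_inner K (\<lambda>i j. Re (spectral_sum K m f i j)) g) =
    cnj (complex_of_real (grid_inner K (\<lambda>i j. Re (spectral_sum K m f i j)) g))"
    by simp
  also have "\<dots> = - complex_of_real (grid_inner K (\<lambda>i j. Re (spectral_sum K m g i j)) f)"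
    unfolding grid_inner_spectral_sum[of m, OF assms(1)]
    by (simp add: assms(2) mult_ac sum_negf)
  finally show ?thesis
    unfolding grid_inner_commute[of K f] by (simp only: of_real_eq_iff flip: of_real_minus)
qed

lemma grid_inner_D_x: "grid_inner K (D_x K f) g = - grid_inner K f (D_x K g)"
  and grid_inner_D_y: "grid_inner K (D_y K f) g = - grid_inner K f (D_y K g)"
  unfolding D_x_def[abs_def] D_y_def[abs_def]
  by (rule grid_inner_spectral_sum_skew; simp)+

lemma grid_inner_divergence: "grid_inner K (divergence K F) g = - grid_inner K F (gradient K g)"
proof -
  have "grid_inner K F (gradient K g) =
    grid_inner K (\<lambda>i j. fst (F i j)) (D_x K g) + grid_inner K (\<lambda>i j. snd (F i j)) (D_y K g)"
    by (simp add: grid_inner_def gradient_def inner_prod_def sum.distrib distrib_left)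
  then show ?thesis
    by (simp add: divergence_def[abs_def] grid_inner_add_left grid_inner_D_x grid_inner_D_y)
qed

lemma laplacian_eq_divergence: "laplacian K f = divergence K (gradient K f)"
  by (intro ext) (simp add: laplacian_def divergence_def gradient_def D_xx_eq D_yy_eq)

lemma grid_inner_laplacian: "grid_inner K (laplacian K f) g = - grid_inner K (gradient K f) (gradient K g)"
  by (simp add: laplacian_eq_divergence grid_inner_divergence)

text \<open>The right side of \<open>grid_inner_laplacian\<close> is symmetric in \<open>f\<close>
  and \<open>g\<close>, hence the Laplacian is self-adjoint.\<close>

lemma grid_inner_bilaplacian:
  "grid_inner K (laplacian K (laplacian K f)) g = grid_inner K (laplacian K f) (laplacian K g)"
  by (metis grid_inner_laplacian grid_inner_commute)

lemma gradient_interpolation: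
  fixes d :: "real grid_fun"
  assumes "t > 0"
  shows "c * grid_inner K (gradient K d) (gradient K d) \<le>
    grid_inner K d d / t + t * c\<^sup>2 / 4 * grid_inner K (laplacian K d) (laplacian K d)"
proof -
  \<comment> \<open>With this \<open>?s\<close> the cross term of the square, divided by
    \<open>t\<close>, is \<open>c\<close> times the inner product of the Laplacian with
    \<open>d\<close>, that is, \<open>- c\<close> times the squared gradient norm.\<close>
  let ?s = "t * c / 2"
  have "0 \<le> grid_inner K (\<lambda>i j. d i j + ?s *\<^sub>R laplacian K d i j) (\<lambda>i j. d i j + ?s *\<^sub>R laplacian K d i j) / t"
    using assms by (simp only: grid_inner_self_nonneg zero_le_divide_iff less_imp_le simp_thms)
  also have "\<dots> = (grid_inner K d d + 2 * ?s * grid_inner K (laplacian K d) d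
      + ?s\<^sup>2 * grid_inner K (laplacian K d) (laplacian K d)) / t"
    by (simp only: grid_inner_square_add)
  also have "\<dots> = grid_inner K d d / t + t * c\<^sup>2 / 4 * grid_inner K (laplacian K d) (laplacian K d)
      + c * grid_inner K (laplacian K d) d"
    using assms by (simp add: field_simps power2_eq_square)
  finally show ?thesis by (simp add: grid_inner_laplacian)
qed

section \<open>Pointwise estimates for the flux and the logarithm\<close>

lemma inner_inverse_square_dist:
  fixes p q :: "'a::real_inner"
  shows "norm (p /\<^sub>R (1 + (norm p)\<^sup>2) - q /\<^sub>R (1 + (norm q)\<^sup>2)) \<le> norm (p - q)"
proof -
  define P where "P = 1 + (norm p)\<^sup>2"
  define Q where "Q = 1 + (norm q)\<^sup>2"
  have PQ: "P \<ge> 1" "Q \<ge> 1" by (simp_all add: P_def Q_def)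
  \<comment> \<open>Denominators are cleared first: the difference of the fluxes is this vector
    divided by \<open>P * Q\<close>.\<close>
  have "(norm (Q *\<^sub>R p - P *\<^sub>R q))\<^sup>2 = P * Q * (norm (p - q))\<^sup>2 - (P - Q)\<^sup>2"
    unfolding P_def Q_def power2_norm_eq_inner
    by (simp add: inner_diff inner_commute[of q p] power2_eq_square algebra_simps)
  also have "\<dots> \<le> (P * Q)\<^sup>2 * (norm (p - q))\<^sup>2"
  proof -
    have "1 \<le> P * Q" using PQ by (metis mult_mono' mult_1 zero_le_one)
    then have "P * Q \<le> (P * Q)\<^sup>2" by (rule self_le_power) simp
    then have "P * Q * (norm (p - q))\<^sup>2 \<le> (P * Q)\<^sup>2 * (norm (p - q))\<^sup>2"
      by (rule mult_right_mono) simp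
    then show ?thesis using zero_le_power2[of "P - Q"] by linarith
  qed
  finally have "(norm (Q *\<^sub>R p - P *\<^sub>R q))\<^sup>2 \<le> (P * Q * norm (p - q))\<^sup>2"
    by (simp only: power_mult_distrib)
  then have le: "norm (Q *\<^sub>R p - P *\<^sub>R q) \<le> P * Q * norm (p - q)"
    by (rule power2_le_imp_le) (use PQ in simp)
  have "Q *\<^sub>R p - P *\<^sub>R q = (P * Q) *\<^sub>R (p /\<^sub>R P - q /\<^sub>R Q)"
    using PQ by (simp add: scaleR_diff_right field_simps)
  then have "norm (Q *\<^sub>R p - P *\<^sub>R q) = P * Q * norm (p /\<^sub>R P - q /\<^sub>R Q)"
    using PQ by (simp only: norm_scaleR) simp
  with le have "P * Q * norm (p /\<^sub>R P - q /\<^sub>R Q) \<le> P * Q * norm (p - q)" by (simp only:)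
  moreover have "0 < P * Q" using PQ by simp
  ultimately have "norm (p /\<^sub>R P - q /\<^sub>R Q) \<le> norm (p - q)"
    by (simp only: mult_le_cancel_left_pos)
  then show ?thesis by (simp only: P_def Q_def)
qed

text \<open>
  The Hessian of \<open>p \<mapsto> - ln (1 + \<bar>p\<bar>\<^sup>2) / 2\<close> is at most \<open>1/8\<close>, with equality at \<open>\<bar>p\<bar>\<^sup>2 = 3\<close>.
\<close>

lemma ln_one_plus_norm_square_ge:
  fixes p q :: "'a::real_inner"
  shows "ln (1 + (norm q)\<^sup>2) / 2 \<ge>
    ln (1 + (norm p)\<^sup>2) / 2 + (p /\<^sub>R (1 + (norm p)\<^sup>2)) \<bullet> (q - p) - (norm (q - p))\<^sup>2 / 16"
proof -
  define \<delta> where "\<delta> = q - p"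
  define D where "D = \<delta> \<bullet> \<delta>"
  define s where "s = (\<lambda>t::real. 1 + (p + t *\<^sub>R \<delta>) \<bullet> (p + t *\<^sub>R \<delta>))"
  define b where "b = (\<lambda>t::real. (p + t *\<^sub>R \<delta>) \<bullet> \<delta>)"
  \<comment> \<open>Along the segment from \<open>p\<close> to \<open>q\<close>, the quadratic term
    adds \<open>D / 8\<close> to the second derivative. This makes \<phi> convex, and the claim is
    that it lies above its tangent at 0.\<close>
  define \<phi> where "\<phi> = (\<lambda>t. ln (s t) / 2 + t\<^sup>2 * D / 16)"
  have s_pos: "s t > 0" for t by (simp add: s_def add_pos_nonneg)
  have s_eq: "s t = 1 + p \<bullet> p + 2 * t * (p \<bullet> \<delta>) + t\<^sup>2 * D" for t
    by (simp add: s_def D_def inner_add inner_commute power2_eq_square algebra_simps)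
  have b_eq: "b t = p \<bullet> \<delta> + t * D" for t
    by (simp add: b_def D_def inner_add)
  have s': "(s has_real_derivative 2 * b t) (at t)" for t
    unfolding s_eq[abs_def] b_eq by (auto intro!: derivative_eq_intros)
  have b': "(b has_real_derivative D) (at t)" for t
    unfolding b_eq[abs_def] by (auto intro!: derivative_eq_intros)
  have \<phi>': "(\<phi> has_real_derivative b t / s t + t * D / 8) (at t)" for t
    unfolding \<phi>_def using s_pos[of t] by (auto intro!: derivative_eq_intros s' simp: field_simps)
  have \<phi>'': "((\<lambda>t. b t / s t + t * D / 8) has_real_derivative
      (D * s t - 2 * (b t)\<^sup>2) / (s t)\<^sup>2 + D / 8) (at t)" for t
    using s_pos[of t]
    by (auto intro!: derivative_eq_intros s' b' simp: field_simps power2_eq_square)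
  have nonneg: "(D * s t - 2 * (b t)\<^sup>2) / (s t)\<^sup>2 + D / 8 \<ge> 0" for t
  proof -
    \<comment> \<open>Inserting this Cauchy-Schwarz bound for \<open>b t\<close> leaves exactly
      \<open>D * (s t - 4)\<^sup>2\<close> as a lower bound for the numerator over
      \<open>8 * (s t)\<^sup>2\<close>.\<close>
    have "(b t)\<^sup>2 \<le> (s t - 1) * D"
      unfolding b_def s_def D_def using Cauchy_Schwarz_ineq[of "p + t *\<^sub>R \<delta>" \<delta>] by simp
    moreover have "D * (s t - 4)\<^sup>2 \<ge> 0" by (simp add: D_def)
    ultimately have "0 \<le> 8 * (D * s t - 2 * (b t)\<^sup>2) + D * (s t)\<^sup>2"
      by (simp add: power2_eq_square algebra_simps)
    then show ?thesis using s_pos[of t] by (simp add: field_simps)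
  qed
  have "convex_on UNIV \<phi>"
    by (rule f''_ge0_imp_convex[OF _ \<phi>' \<phi>'' nonneg]) simp
  then have "\<phi> 1 - \<phi> 0 \<ge> (b 0 / s 0 + 0 * D / 8) * (1 - 0)"
    by (rule convex_on_imp_above_tangent[where A = UNIV])
      (use \<phi>'[of 0] in \<open>auto simp: has_field_derivative_at_within\<close>)
  then have "\<phi> 1 - \<phi> 0 \<ge> b 0 / s 0" by simp
  moreover have "\<phi> 1 = ln (1 + (norm q)\<^sup>2) / 2 + (norm (q - p))\<^sup>2 / 16"
    "\<phi> 0 = ln (1 + (norm p)\<^sup>2) / 2"
    by (simp_all add: \<phi>_def s_def D_def \<delta>_def power2_norm_eq_inner)
  moreover have "b 0 / s 0 = (p /\<^sub>R (1 + (norm p)\<^sup>2)) \<bullet> (q - p)"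
    by (simp add: b_def s_def \<delta>_def power2_norm_eq_inner divide_inverse mult.commute)
  ultimately show ?thesis by linarith
qed

section \<open>Estimates for the nonlinear terms\<close>

lemma energy_c1_diff_le:
  "energy_c1 K v - energy_c1 K w \<le>
    - grid_inner K (nonlin_flux K w) (gradient K (\<lambda>i j. v i j - w i j))
    + grid_inner K (gradient K (\<lambda>i j. v i j - w i j)) (gradient K (\<lambda>i j. v i j - w i j)) / 16"
proof -
  let ?G = "gradient K (\<lambda>i j. v i j - w i j)"
  have "energy_c1 K v - energy_c1 K w =
    (mesh K)\<^sup>2 * (\<Sum>i = 0..<int (grid_size K). \<Sum>j = 0..<int (grid_size K).
      ln (1 + (norm (gradient K w i j))\<^sup>2) / 2 - ln (1 + (norm (gradient K v i j))\<^sup>2) / 2)"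
    by (simp add: energy_c1_def sum_subtractf sum_negf algebra_simps)
  also have "\<dots> \<le> (mesh K)\<^sup>2 * (\<Sum>i = 0..<int (grid_size K). \<Sum>j = 0..<int (grid_size K).
      ?G i j \<bullet> ?G i j / 16 - nonlin_flux K w i j \<bullet> ?G i j)"
  proof (intro mult_left_mono sum_mono)
    fix i j
    show "ln (1 + (norm (gradient K w i j))\<^sup>2) / 2 - ln (1 + (norm (gradient K v i j))\<^sup>2) / 2
      \<le> ?G i j \<bullet> ?G i j / 16 - nonlin_flux K w i j \<bullet> ?G i j"
      using ln_one_plus_norm_square_ge[of "gradient K w i j" "gradient K v i j"]
      unfolding nonlin_flux_def gradient_diff power2_norm_eq_inner by linarith
  qed simp
  also have "\<dots> = - grid_inner K (nonlin_flux K w) ?G + grid_inner K ?G ?G / 16"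
    by (simp add: grid_inner_def sum_subtractf right_diff_distrib flip: sum_divide_distrib)
  finally show ?thesis .
qed

text \<open>Young's inequality combined with the Lipschitz bound; it controls the error of
  extrapolating the flux from earlier steps.\<close>

lemma nonlin_flux_diff_inner_le:
  "\<bar>grid_inner K (nonlin_flux K v) G - grid_inner K (nonlin_flux K w) G\<bar> \<le>
    (grid_inner K (gradient K (\<lambda>i j. v i j - w i j)) (gradient K (\<lambda>i j. v i j - w i j))
     + grid_inner K G G) / 2"
proof -
  let ?F = "\<lambda>i j. nonlin_flux K v i j - nonlin_flux K w i j"
  have "grid_inner K ?F ?F \<le>
    grid_inner K (gradient K (\<lambda>i j. v i j - w i j)) (gradient K (\<lambda>i j. v i j - w i j))"
    unfolding nonlin_flux_def gradient_diff
    by (intro grid_inner_mono) (simp add: gradient_diff inner_inverse_square_dist flip: norm_le)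
  then show ?thesis
    using grid_inner_abs_le[of K ?F G] by (simp add: grid_inner_diff_left)
qed

section \<open>Testing the scheme with the increment\<close>

lemma bdf3_step_tested:
  fixes v3 v2 v1 v0 :: "real grid_fun"
  assumes "bdf3_step K \<epsilon> A \<tau> v3 v2 v1 v0"
  defines "d3 \<equiv> \<lambda>i j. v3 i j - v2 i j" and "d2 \<equiv> \<lambda>i j. v2 i j - v1 i j"
    and "d1 \<equiv> \<lambda>i j. v1 i j - v0 i j"
  shows "(11 / 6 * grid_inner K d3 d3 - 7 / 6 * grid_inner K d2 d3 + 1 / 3 * grid_inner K d1 d3) / \<tau>
    + \<epsilon>\<^sup>2 * grid_inner K (laplacian K v3) (laplacian K d3)
    - (3 * grid_inner K (nonlin_flux K v2) (gradient K d3)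
       - 3 * grid_inner K (nonlin_flux K v1) (gradient K d3)
       + grid_inner K (nonlin_flux K v0) (gradient K d3))
    + A * \<tau>\<^sup>2 * grid_inner K (laplacian K d3) (laplacian K d3) = 0"
proof -
  let ?F = "\<lambda>i j. 3 *\<^sub>R nonlin_flux K v2 i j - 3 *\<^sub>R nonlin_flux K v1 i j + nonlin_flux K v0 i j"
  have "(\<lambda>i j. (11 / 6 * d3 i j - 7 / 6 * d2 i j + 1 / 3 * d1 i j) / \<tau>
      + \<epsilon>\<^sup>2 * laplacian K (laplacian K v3) i j + divergence K ?F i j
      + (A * \<tau>\<^sup>2) * laplacian K (laplacian K d3) i j) = (\<lambda>i j. 0)"
  proof (intro ext)
    fix i j
    \<comment> \<open>The BDF coefficients sum to zero, so the quotient is a combination of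
      successive increments.\<close>
    have "11 / 6 * d3 i j - 7 / 6 * d2 i j + 1 / 3 * d1 i j =
        11 / 6 * v3 i j - 3 * v2 i j + 3 / 2 * v1 i j - 1 / 3 * v0 i j"
      unfolding d1_def d2_def d3_def by (simp add: field_simps)
    then show "(11 / 6 * d3 i j - 7 / 6 * d2 i j + 1 / 3 * d1 i j) / \<tau>
      + \<epsilon>\<^sup>2 * laplacian K (laplacian K v3) i j + divergence K ?F i j
      + (A * \<tau>\<^sup>2) * laplacian K (laplacian K d3) i j = 0"
      using assms(1) by (simp add: bdf3_step_def d3_def)
  qed
  then have "grid_inner K (\<lambda>i j. (11 / 6 * d3 i j - 7 / 6 * d2 i j + 1 / 3 * d1 i j) / \<tau>
      + \<epsilon>\<^sup>2 * laplacian K (laplacian K v3) i j + divergence K ?F i j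
      + (A * \<tau>\<^sup>2) * laplacian K (laplacian K d3) i j) d3 = 0"
    by (simp add: grid_inner_def)
  then show ?thesis
    by (simp only: grid_inner_linear grid_inner_bilaplacian grid_inner_divergence)
qed

text \<open>Applied to Laplacians, this turns the implicit term of the scheme into a telescoping
  energy difference plus a dissipative square.\<close>

lemma grid_inner_diff_polarization:
  "grid_inner K v (\<lambda>i j. v i j - w i j) =
    (grid_inner K v v - grid_inner K w w
     + grid_inner K (\<lambda>i j. v i j - w i j) (\<lambda>i j. v i j - w i j)) / 2"
  by (simp add: grid_inner_diff_left grid_inner_commute[of K _ "\<lambda>i j. v i j - w i j"]
      grid_inner_commute[of K v w])

lemma stabilization_bound:
  fixes \<epsilon> A \<tau> c :: real
  assumes "\<epsilon> > 0" and "A \<ge> 9 / 32 * c ^ 4 * \<epsilon> powi (- 2)"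
  shows "3 * \<tau> * c\<^sup>2 / 4 \<le> \<epsilon>\<^sup>2 / 2 + A * \<tau>\<^sup>2"
proof -
  \<comment> \<open>AM-GM by completing the square: the cross product is
    \<open>3 / 4 * c\<^sup>2 * \<tau>\<close>, and half the square of \<open>3 / 4\<close> is the
    constant \<open>9 / 32\<close>.\<close>
  have "0 \<le> (\<epsilon> - 3 / 4 * c\<^sup>2 * \<tau> / \<epsilon>)\<^sup>2 / 2" by simp
  also have "\<dots> = \<epsilon>\<^sup>2 / 2 - 3 * \<tau> * c\<^sup>2 / 4 + (9 / 32 * c ^ 4 * \<epsilon> powi (- 2)) * \<tau>\<^sup>2"
    using assms(1)
    by (simp add: power_int_minus field_simps power2_eq_square power4_eq_xxxx)
  also have "\<dots> \<le> \<epsilon>\<^sup>2 / 2 - 3 * \<tau> * c\<^sup>2 / 4 + A * \<tau>\<^sup>2"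
    using mult_right_mono[OF assms(2), of "\<tau>\<^sup>2"] by simp
  finally show ?thesis by simp
qed

section \<open>Energy decay in one step\<close>

lemma modified_energy_decreasing:
  assumes "\<epsilon> > 0" and A: "A \<ge> 9 / 32 * (49 / 16) ^ 4 * \<epsilon> powi (- 2)" and \<tau>: "\<tau> > 0"
    and step: "bdf3_step K \<epsilon> A \<tau> v3 v2 v1 v0"
  shows "modified_energy K \<epsilon> \<tau> v3 v2 v1 \<le> modified_energy K \<epsilon> \<tau> v2 v1 v0"
proof -
  define d3 where "d3 = (\<lambda>i j. v3 i j - v2 i j)"
  define d2 where "d2 = (\<lambda>i j. v2 i j - v1 i j)"
  define d1 where "d1 = (\<lambda>i j. v1 i j - v0 i j)"
  note d = d3_def[symmetric] d2_def[symmetric] d1_def[symmetric]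
  let ?I = "\<lambda>f. grid_inner K f f"
  let ?L = "laplacian K" and ?G = "gradient K"
  let ?T = "11 / 6 * ?I d3 - 7 / 6 * grid_inner K d2 d3 + 1 / 3 * grid_inner K d1 d3"
  let ?B = "\<lambda>v. grid_inner K (nonlin_flux K v) (?G d3)"
  have tested: "?T / \<tau> + \<epsilon>\<^sup>2 * grid_inner K (?L v3) (?L d3) - (3 * ?B v2 - 3 * ?B v1 + ?B v0)
      + A * \<tau>\<^sup>2 * ?I (?L d3) = 0"
    using bdf3_step_tested[OF step] unfolding d .
  have lap: "grid_inner K (?L v3) (?L d3) = (?I (?L v3) - ?I (?L v2) + ?I (?L d3)) / 2"
    using grid_inner_diff_polarization[of K "?L v3" "?L v2"]
    unfolding laplacian_diff[of K v3 v2, symmetric, abs_def] d by simp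
  \<comment> \<open>Young's inequality on both cross terms:
    \<open>13 / 12 = 11 / 6 - 7 / 12 - 1 / 6\<close>.\<close>
  have "13 / 12 * ?I d3 - 7 / 12 * ?I d2 - 1 / 6 * ?I d1 \<le> ?T"
    using grid_inner_abs_le[of K d2 d3] grid_inner_abs_le[of K d1 d3] by (simp add: abs_le_iff)
  then have "(13 / 12 * ?I d3 - 7 / 12 * ?I d2 - 1 / 6 * ?I d1) / \<tau> \<le> ?T / \<tau>"
    using \<tau> by (simp add: divide_right_mono)
  \<comment> \<open>Split \<open>13 / 12 = 3 / 4 + 1 / 3\<close>: the first part belongs to the new
    modified energy, the second is spare. For \<open>d2\<close>,
    \<open>3 / 4 - 7 / 12 = 1 / 6\<close> remains.\<close>
  then have temporal: "3 / (4 * \<tau>) * ?I d3 + 1 / (6 * \<tau>) * ?I d2 + ?I d3 / (3 * \<tau>)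
      \<le> ?T / \<tau> + 3 / (4 * \<tau>) * ?I d2 + 1 / (6 * \<tau>) * ?I d1"
    using \<tau> by (simp add: field_simps)
  \<comment> \<open>With \<open>Fi\<close> the flux of \<open>vi\<close>,
    \<open>3 F2 - 3 F1 + F0 = F2 + 2 (F2 - F1) - (F1 - F0)\<close>. The two differences cost
    \<open>1 + 1 / 2\<close> of the new gradient term, and the logarithm
    \<open>1 / 16\<close>.\<close>
  have nonlin: "energy_c1 K v3 - energy_c1 K v2 \<le>
      - (3 * ?B v2 - 3 * ?B v1 + ?B v0) + 25 / 16 * ?I (?G d3) + ?I (?G d2) + ?I (?G d1) / 2"
    using energy_c1_diff_le[of K v3 v2] nonlin_flux_diff_inner_le[of K v2 "?G d3" v1]
      nonlin_flux_diff_inner_le[of K v1 "?G d3" v0]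
    unfolding d abs_le_iff by (simp add: field_simps)
  \<comment> \<open>\<open>49 / 16\<close> is \<open>25 / 16\<close> from \<open>nonlin\<close> plus
    \<open>3 / 2\<close> from the new modified energy; \<open>t = 3 * \<tau>\<close> matches the
    spare term of \<open>temporal\<close>.\<close>
  have "49 / 16 * ?I (?G d3) \<le> ?I d3 / (3 * \<tau>) + 3 * \<tau> * (49 / 16)\<^sup>2 / 4 * ?I (?L d3)"
    using gradient_interpolation[of "3 * \<tau>" "49 / 16" K d3] \<tau> by simp
  also have "\<dots> \<le> ?I d3 / (3 * \<tau>) + (\<epsilon>\<^sup>2 / 2 + A * \<tau>\<^sup>2) * ?I (?L d3)"
    by (intro add_left_mono mult_right_mono stabilization_bound assms grid_inner_self_nonneg)
  finally have interp: "49 / 16 * ?I (?G d3) \<le>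
      ?I d3 / (3 * \<tau>) + \<epsilon>\<^sup>2 / 2 * ?I (?L d3) + A * \<tau>\<^sup>2 * ?I (?L d3)"
    by (simp add: algebra_simps)
  \<comment> \<open>Distributing the factor one half exposes the biharmonic parts of the two
    energies as separate terms for the final linear combination.\<close>
  have tested': "?T / \<tau> + \<epsilon>\<^sup>2 / 2 * ?I (?L v3) - \<epsilon>\<^sup>2 / 2 * ?I (?L v2) + \<epsilon>\<^sup>2 / 2 * ?I (?L d3)
      - (3 * ?B v2 - 3 * ?B v1 + ?B v0) + A * \<tau>\<^sup>2 * ?I (?L d3) = 0"
    using tested unfolding lap by (simp add: algebra_simps add_divide_distrib diff_divide_distrib)
  show ?thesis
    unfolding modified_energy_def energy_def grid_norm_power2 d
    using tested' temporal nonlin interp by linarith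
qed

theorem theorem2p6:
  fixes K :: nat and \<epsilon> A \<tau> :: real and u :: "nat \<Rightarrow> real grid_fun"
  assumes "K > 0"
    and "\<epsilon> > 0"
    and "A \<ge> 9 / 32 * (49 / 16) ^ 4 * \<epsilon> powi (- 2)"
    and "\<tau> > 0"
    and "\<And>n. periodic_grid_fun K (u n)"
    and "\<And>n. n \<ge> 2 \<Longrightarrow> bdf3_step K \<epsilon> A \<tau> (u (n + 1)) (u n) (u (n - 1)) (u (n - 2))"
  shows "\<forall>n\<ge>2. modified_energy K \<epsilon> \<tau> (u (n + 1)) (u n) (u (n - 1))
               \<le> modified_energy K \<epsilon> \<tau> (u n) (u (n - 1)) (u (n - 2))"
  using assms(2-4,6) modified_energy_decreasing by blast

end
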